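(* Let $\mathbb{S}_1$, $\mathbb{S}_2$, and $\mathbb{S}_3$ be metric spaces, let $\mathcal{A}$ be a set of real-valued lower semi-continuous functions on $\mathbb{S}_1\times\mathbb{S}_2$ which is lower semi-equicontinuous and uniformly bounded, and let a stochastic kernel $\Psi(ds_2|s_3)$ on $\mathbb{S}_2$ given $\mathbb{S}_3$ be weakly continuous. If $\mathbb{S}_2$ is separable, then the set of functions $$\mathcal{A}^\Psi:=\left\{(s_1,s_3)\mapsto\int_{\mathbb{S}_2}f(s_1,s_2)\,\Psi(ds_2|s_3)\,:\, f\in\mathcal{A}\right\}$$ defined on $\mathbb{S}_1\times\mathbb{S}_3$ is lower semi-equicontinuous and uniformly bounded by the same constant as the set $\mathcal{A}$.
   Context: Products of metric spaces carry the product topology. $\mathcal{B}(\mathbb{S})$ denotes the Borel $\sigma$-field of a metric space $\mathbb{S}$. A set $\mathtt{F}$ of real-valued functions on a metric space $\mathbb{S}$ is lower semi-equicontinuous at $s\in\mathbb{S}$ if $\liminf_{s'\to s}\inf_{f\in\mathtt{F}}(f(s')-f(s))\ge 0$; it is lower semi-equicontinuous (on $\mathbb{S}$) if this holds at every $s\in\mathbb{S}$. It is uniformly bounded (by a constant $M<+\infty$) if $|f(s)|\le M$ for all $s\in\mathbb{S}$ and all $f\in\mathtt{F}$. A stochastic kernel $\Psi(ds_2|s_3)$ on $\mathbb{S}_2$ given $\mathbb{S}_3$ is a mapping $\Psi:\mathcal{B}(\mathbb{S}_2)\times\mathbb{S}_3\to[0,1]$ such that $\Psi(\,\cdot\,|s_3)$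 is a probability measure on $\mathbb{S}_2$ for every $s_3\in\mathbb{S}_3$, and $\Psi(B|\,\cdot\,)$ is Borel-measurable on $\mathbb{S}_3$ for every $B\in\mathcal{B}(\mathbb{S}_2)$. It is weakly continuous if $\Psi(\,\cdot\,|s_3^{(n)})$ converges weakly to $\Psi(\,\cdot\,|s_3)$ (i.e., integrals of every bounded continuous function on $\mathbb{S}_2$ converge) whenever $s_3^{(n)}\to s_3$ in $\mathbb{S}_3$. *)

theory Defs
  imports "HOL-Probability.Probability"
begin

text \<open>
  The limits inferior below are taken in the extended reals, over punctured neighbourhoods. Including
  the point itself would change nothing: there the quantity under the limit equals the value it is
  compared with (or is top, for the infimum over an empty family). At an isolated point the
  filter \<^term>\<open>at s\<close> is trivial and both conditions hold.
\<close>

definition lower_semi_continuous :: "('s::metric_space \<Rightarrow> real) \<Rightarrow> bool" where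
  "lower_semi_continuous f \<longleftrightarrow> (\<forall>s. Liminf (at s) (\<lambda>s'. ereal (f s')) \<ge> ereal (f s))"

definition lower_semi_equicontinuous_at :: "('s::metric_space \<Rightarrow> real) set \<Rightarrow> 's \<Rightarrow> bool" where
  "lower_semi_equicontinuous_at F s \<longleftrightarrow>
     Liminf (at s) (\<lambda>s'. INF f\<in>F. ereal (f s' - f s)) \<ge> 0"

definition lower_semi_equicontinuous :: "('s::metric_space \<Rightarrow> real) set \<Rightarrow> bool" where
  "lower_semi_equicontinuous F \<longleftrightarrow> (\<forall>s. lower_semi_equicontinuous_at F s)"

definition uniformly_bounded_by :: "real \<Rightarrow> ('s \<Rightarrow> real) set \<Rightarrow> bool" where
  "uniformly_bounded_by M F \<longleftrightarrow> (\<forall>f\<in>F. \<forall>s. \<bar>f s\<bar> \<le> M)"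

definition stochastic_kernel ::
  "('s3::metric_space \<Rightarrow> 's2::metric_space measure) \<Rightarrow> bool" where
  "stochastic_kernel \<Psi> \<longleftrightarrow>
     (\<forall>s. prob_space (\<Psi> s) \<and> sets (\<Psi> s) = sets borel) \<and>
     (\<forall>B\<in>sets borel. (\<lambda>s. measure (\<Psi> s) B) \<in> borel_measurable borel)"

lemma stochastic_kernel_iff_measurable:
  "stochastic_kernel \<Psi> \<longleftrightarrow> \<Psi> \<in> borel \<rightarrow>\<^sub>M prob_algebra borel"
proof
  assume K: "stochastic_kernel \<Psi>"
  show "\<Psi> \<in> borel \<rightarrow>\<^sub>M prob_algebra borel"
  proof (rule measurable_prob_algebraI)
    show "prob_space (\<Psi> s)" for s
      using K by (simp add: stochastic_kernel_def)
    show "\<Psi> \<in> borel \<rightarrow>\<^sub>M subprob_algebra borel"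
    proof (rule measurable_subprob_algebra)
      fix B :: "'b set" assume B: "B \<in> sets borel"
      have "(\<lambda>s. emeasure (\<Psi> s) B) = (\<lambda>s. ennreal (measure (\<Psi> s) B))"
        using K by (auto simp: stochastic_kernel_def prob_space_def finite_measure.emeasure_eq_measure)
      then show "(\<lambda>s. emeasure (\<Psi> s) B) \<in> borel_measurable borel"
        using K B by (simp add: stochastic_kernel_def)
    qed (use K in \<open>auto simp: stochastic_kernel_def prob_space_imp_subprob_space\<close>)
  qed
next
  assume K: "\<Psi> \<in> borel \<rightarrow>\<^sub>M prob_algebra borel"
  then have "\<Psi> s \<in> space (prob_algebra borel)" for s
    by (rule measurable_space) simp
  then show "stochastic_kernel \<Psi>"
    using measurable_compose[OF measurable_prob_algebraD[OF K] measurable_measure_subprob_algebra]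
    by (auto simp: stochastic_kernel_def space_prob_algebra)
qed

definition weakly_converges ::
  "(nat \<Rightarrow> 's::metric_space measure) \<Rightarrow> 's measure \<Rightarrow> bool" where
  "weakly_converges \<mu> \<nu> \<longleftrightarrow>
     (\<forall>g::'s \<Rightarrow> real. continuous_on UNIV g \<and> bounded (range g) \<longrightarrow>
        (\<lambda>n. \<integral>s. g s \<partial>\<mu> n) \<longlonglongrightarrow> (\<integral>s. g s \<partial>\<nu>))"

definition weakly_continuous_kernel ::
  "('s3::metric_space \<Rightarrow> 's2::metric_space measure) \<Rightarrow> bool" where
  "weakly_continuous_kernel \<Psi> \<longleftrightarrow>
     (\<forall>x s. x \<longlonglongrightarrow> s \<longrightarrow> weakly_converges (\<lambda>n. \<Psi> (x n)) (\<Psi> s))"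

definition kernel_integrals ::
  "('s3 \<Rightarrow> 's2 measure) \<Rightarrow> ('s1 \<times> 's2 \<Rightarrow> real) set \<Rightarrow> ('s1 \<times> 's3 \<Rightarrow> real) set" where
  "kernel_integrals \<Psi> A = {(\<lambda>(s1, s3). \<integral>s2. f (s1, s2) \<partial>\<Psi> s3) | f. f \<in> A}"

end

theory Submission
  imports Defs
begin

text \<open>
  Fix \<open>(a, c)\<close> and \<open>e > 0\<close>. By equicontinuity and separability, countably many open boxes
  \<open>R i \<times> B i\<close> around the points of \<open>{a} \<times> S2\<close> carry Borel sets \<open>C i \<subseteq> B i\<close> covering \<open>S2\<close> such that
  \<open>f (a, y) - e\<close> is a lower bound of \<open>f\<close> on the box whenever \<open>y \<in> C i\<close>, for all \<open>f\<close> at once.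
  Finitely many \<open>C i\<close> already carry almost all of \<open>\<Psi> c\<close>. The corresponding boxes give, for each
  \<open>f\<close>, a step function \<open>\<phi> f\<close> with \<open>\<phi> f \<le> f (u, _) + M\<close> for all \<open>u\<close> near \<open>a\<close>, and
  \<open>f (a, _) + M - 2 * e \<le> \<phi> f\<close> off a set of small measure. All superlevel sets of the \<open>\<phi> f\<close> are
  unions of the same finitely many \<open>B i\<close>, hence only finitely many open sets occur, and the
  portmanteau inequality for these yields a bound that is uniform in \<open>f\<close>.
\<close>

section \<open>Epsilon-delta form of lower semi-equicontinuity; sections and measurability\<close>

lemma lower_semi_equicontinuous_at_iff:
  "lower_semi_equicontinuous_at F s \<longleftrightarrow>
     (\<forall>e>0. \<exists>d>0. \<forall>s'. dist s' s < d \<longrightarrow> (\<forall>f\<in>F. f s - e \<le> f s'))"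
proof
  assume F: "lower_semi_equicontinuous_at F s"
  show "\<forall>e>0. \<exists>d>0. \<forall>s'. dist s' s < d \<longrightarrow> (\<forall>f\<in>F. f s - e \<le> f s')"
  proof (intro allI impI)
    fix e :: real
    assume "e > 0"
    then have "ereal (- e) < 0"
      by simp
    then have "\<forall>\<^sub>F s' in at s. ereal (- e) < (INF f\<in>F. ereal (f s' - f s))"
      using F unfolding lower_semi_equicontinuous_at_def le_Liminf_iff by blast
    then obtain d where d: "d > 0"
      "\<And>s'. s' \<noteq> s \<Longrightarrow> dist s' s < d \<Longrightarrow> ereal (- e) < (INF f\<in>F. ereal (f s' - f s))"
      unfolding eventually_at by auto
    have "f s - e \<le> f s'" if "dist s' s < d" "f \<in> F" for s' f
    proof (cases "s' = s")
      case False
      from less_INF_D[OF d(2)[OF False that(1)] that(2)] show ?thesis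
        by simp
    qed (use \<open>e > 0\<close> in simp)
    with d(1) show "\<exists>d>0. \<forall>s'. dist s' s < d \<longrightarrow> (\<forall>f\<in>F. f s - e \<le> f s')"
      by blast
  qed
next
  assume F: "\<forall>e>0. \<exists>d>0. \<forall>s'. dist s' s < d \<longrightarrow> (\<forall>f\<in>F. f s - e \<le> f s')"
  show "lower_semi_equicontinuous_at F s"
    unfolding lower_semi_equicontinuous_at_def le_Liminf_iff
  proof (intro allI impI)
    fix y :: ereal
    assume "y < 0"
    \<comment> \<open>A real \<open>a\<close> strictly between is inserted because termwise bounds
      give only a non-strict bound on the infimum; it also covers \<open>y\<close> equal to minus
      infinity.\<close>
    then obtain a where a: "y < ereal a" "a < 0"
      using ereal_dense2[of y 0] by auto
    then obtain d where d: "d > 0" "\<And>s' f. dist s' s < d \<Longrightarrow> f \<in> F \<Longrightarrow> f s + a \<le> f s'"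
      using F[rule_format, of "- a"] by auto
    have "y < (INF f\<in>F. ereal (f s' - f s))" if "dist s' s < d" for s'
    proof -
      have "ereal a \<le> (INF f\<in>F. ereal (f s' - f s))"
        using d(2)[OF that] by (intro INF_greatest) (auto simp: algebra_simps)
      with a(1) show ?thesis
        by (rule less_le_trans)
    qed
    with d(1) show "\<forall>\<^sub>F s' in at s. y < (INF f\<in>F. ereal (f s' - f s))"
      unfolding eventually_at by blast
  qed
qed

text \<open>Moving only the second coordinate leaves distances unchanged, so the same radius works.
  This lets closedness and measurability be argued directly on the second factor, where the kernel
  lives.\<close>

lemma lower_semi_equicontinuous_at_section:
  assumes "lower_semi_equicontinuous_at F (a, y)"
  shows "lower_semi_equicontinuous_at ((\<lambda>f y. f (a, y)) ` F) y"
  unfolding lower_semi_equicontinuous_at_iff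
proof (intro allI impI)
  fix e :: real
  assume "e > 0"
  then obtain d where "d > 0" "\<And>s' f. dist s' (a, y) < d \<Longrightarrow> f \<in> F \<Longrightarrow> f (a, y) - e \<le> f s'"
    using assms unfolding lower_semi_equicontinuous_at_iff by blast
  then show "\<exists>d>0. \<forall>y'. dist y' y < d \<longrightarrow> (\<forall>g\<in>(\<lambda>f y. f (a, y)) ` F. g y - e \<le> g y')"
    by (intro exI[of _ d]) (auto simp: dist_Pair_Pair)
qed

lemma lower_semi_equicontinuous_closed_sublevel:
  assumes "lower_semi_equicontinuous F" "f \<in> F"
  shows "closed {y. f y \<le> c}"
proof -
  have "open {y. c < f y}"
    unfolding open_dist
  proof safe
    fix y
    assume "c < f y"
    \<comment> \<open>Giving up only half of the gap keeps the values near \<open>y\<close> strictly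
      above \<open>c\<close>.\<close>
    then have "0 < (f y - c) / 2"
      by simp
    then obtain d where d: "d > 0"
      "\<And>y'. dist y' y < d \<Longrightarrow> f y - (f y - c) / 2 \<le> f y'"
      using assms unfolding lower_semi_equicontinuous_def lower_semi_equicontinuous_at_iff by meson
    have "c < f y'" if "dist y' y < d" for y'
      using d(2)[OF that] \<open>c < f y\<close> by (simp add: field_simps)
    with d(1) show "\<exists>d>0. \<forall>y'. dist y' y < d \<longrightarrow> y' \<in> {y. c < f y}"
      by auto
  qed
  moreover have "{y. c < f y} = - {y. f y \<le> c}"
    by auto
  ultimately show ?thesis
    by (simp add: closed_open)
qed

lemma lower_semi_equicontinuous_borel_measurable:
  assumes "lower_semi_equicontinuous F" "f \<in> F"
  shows "f \<in> borel_measurable borel"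
  using lower_semi_equicontinuous_closed_sublevel[OF assms]
  by (auto simp: borel_measurable_iff_le)

section \<open>Weak continuity along neighbourhoods and the portmanteau inequality\<close>

text \<open>Continuity at a point of a metric space is sequential continuity. The filter form allows
  finitely many such conditions to be combined later.\<close>

lemma weakly_continuous_kernel_tendsto:
  fixes g :: "'b::metric_space \<Rightarrow> real"
  assumes "weakly_continuous_kernel \<Psi>" "continuous_on UNIV g" "bounded (range g)"
  shows "((\<lambda>s. \<integral>y. g y \<partial>\<Psi> s) \<longlongrightarrow> (\<integral>y. g y \<partial>\<Psi> s0)) (nhds s0)"
proof -
  have "isCont (\<lambda>s. \<integral>y. g y \<partial>\<Psi> s) s0"
    using assms unfolding continuous_at_sequentially weakly_continuous_kernel_def weakly_converges_def
    by (auto simp: o_def)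
  then show ?thesis
    using tendsto_at_iff_tendsto_nhds[of "\<lambda>s. \<integral>y. g y \<partial>\<Psi> s" s0] by (simp add: isCont_def)
qed

text \<open>This is the portmanteau inequality for open sets: the indicator of \<open>U\<close> is a
  limit from below of bounded continuous functions, whose integrals depend continuously on the
  parameter.\<close>

lemma weakly_continuous_kernel_open:
  assumes \<Psi>: "stochastic_kernel \<Psi>" "weakly_continuous_kernel \<Psi>"
    and U: "open U" and e: "e > 0"
  shows "\<forall>\<^sub>F s in nhds s0. measure (\<Psi> s0) U - e < measure (\<Psi> s) U"
proof (cases "U = UNIV")
  case True
  have "measure (\<Psi> s) UNIV = 1" for s
  proof -
    interpret prob_space "\<Psi> s"
      using \<Psi> by (simp add: stochastic_kernel_def)
    have "space (\<Psi> s) = UNIV"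
      using \<Psi> sets_eq_imp_space_eq[of "\<Psi> s" borel] by (simp add: stochastic_kernel_def)
    with prob_space show ?thesis
      by simp
  qed
  with True e show ?thesis
    by simp
next
  case False
  have [measurable_cong]: "sets (\<Psi> s) = sets borel" for s
    using \<Psi> by (simp add: stochastic_kernel_def)
  have prob: "prob_space (\<Psi> s)" for s
    using \<Psi> by (simp add: stochastic_kernel_def)
  have [measurable]: "U \<in> sets borel"
    using U by simp
  \<comment> \<open>Distance to the complement, steepened by \<open>k\<close> and cut off at 1. The
    complement must be nonempty, since \<open>infdist\<close> to the empty set is 0 and
    \<open>g k\<close> would vanish; hence the separate case for \<open>UNIV\<close>.\<close>
  define g where "g k y = min 1 (real k * infdist y (- U))" for k y
  have g_cont: "continuous_on UNIV (g k)" for k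
    unfolding g_def by (intro continuous_intros)
  have g_bounds: "0 \<le> g k y" "g k y \<le> 1" for k y
    by (auto simp: g_def infdist_nonneg)
  have [measurable]: "g k \<in> borel_measurable borel" for k
    by (rule borel_measurable_continuous_onI[OF g_cont])
  have g_le: "g k y \<le> indicat_real U y" for k y
    using g_bounds(2)[of k y] by (cases "y \<in> U") (auto simp: g_def)
  have g_lim: "(\<lambda>k. g k y) \<longlonglongrightarrow> indicat_real U y" for y
  proof (cases "y \<in> U")
    case True
    have "infdist y (- U) \<noteq> 0"
      using in_closed_iff_infdist_zero[of "- U" y] U False True by (auto simp: closed_def)
    then have pos: "infdist y (- U) > 0"
      using infdist_nonneg[of y "- U"] by simp
    then obtain n where n: "1 < real n * infdist y (- U)"
      using reals_Archimedean3 by blast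
    have "g k y = 1" if "n \<le> k" for k
    proof -
      have "real n * infdist y (- U) \<le> real k * infdist y (- U)"
        using that pos by (intro mult_right_mono) auto
      with n show ?thesis
        by (simp add: g_def)
    qed
    then have "\<forall>\<^sub>F k in sequentially. g k y = 1"
      unfolding eventually_sequentially by blast
    with True show ?thesis
      by (simp add: tendsto_eventually)
  qed (simp add: g_def)
  have integrable_g: "integrable (\<Psi> s) (g k)" for s k
  proof -
    interpret prob_space "\<Psi> s" by (rule prob)
    show ?thesis
      using g_bounds by (intro integrable_const_bound[where B = 1]) auto
  qed
  have int_le: "(\<integral>y. g k y \<partial>\<Psi> s) \<le> measure (\<Psi> s) U" for s k
  proof -
    interpret prob_space "\<Psi> s" by (rule prob)
    have "(\<integral>y. g k y \<partial>\<Psi> s) \<le> (\<integral>y. indicat_real U y \<partial>\<Psi> s)"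
      by (intro integral_mono integrable_g g_le integrable_real_indicator) (simp_all add: less_top[symmetric])
    then show ?thesis
      by simp
  qed
  have "(\<lambda>k. \<integral>y. g k y \<partial>\<Psi> s0) \<longlonglongrightarrow> (\<integral>y. indicat_real U y \<partial>\<Psi> s0)"
  proof -
    interpret prob_space "\<Psi> s0" by (rule prob)
    show ?thesis
      by (rule integral_dominated_convergence[where w = "\<lambda>_. 1"]) (use g_lim g_bounds in auto)
  qed
  then have "(\<lambda>k. \<integral>y. g k y \<partial>\<Psi> s0) \<longlonglongrightarrow> measure (\<Psi> s0) U"
    by simp
  then have "\<forall>\<^sub>F k in sequentially. measure (\<Psi> s0) U - e < (\<integral>y. g k y \<partial>\<Psi> s0)"
    by (rule order_tendstoD) (use e in simp)
  then obtain k where k: "measure (\<Psi> s0) U - e < (\<integral>y. g k y \<partial>\<Psi> s0)"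
    using eventually_happens[of _ sequentially] by auto
  have "bounded (range (g k))"
    by (rule boundedI[of _ 1]) (use g_bounds in auto)
  \<comment> \<open>A single \<open>k\<close> suffices: the integral of \<open>g k\<close> stays
    above the threshold near \<open>s0\<close> and is below the measure of \<open>U\<close> at every
    parameter.\<close>
  from order_tendstoD(1)[OF weakly_continuous_kernel_tendsto[OF \<Psi>(2) g_cont this] k]
  show ?thesis
    by (rule eventually_mono) (use int_le less_le_trans in blast)
qed

section \<open>Dense sequences and rounding by counting levels\<close>

lemma separable_dense_sequence:
  assumes "separable_space (euclidean :: 'a::metric_space topology)"
  obtains z :: "nat \<Rightarrow> 'a::metric_space" where "\<And>y e. e > 0 \<Longrightarrow> \<exists>j. dist (z j) y < e"
proof -
  obtain D :: "'a::metric_space set" where D: "countable D" "closure D = UNIV"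
    using assms by (auto simp: separable_space_def)
  then have "D \<noteq> {}"
    by auto
  have "\<exists>j. dist (from_nat_into D j) y < e" if e: "e > 0" for y e
  proof -
    have "y \<in> closure D"
      using D by simp
    then obtain x where "x \<in> D" "dist x y < e"
      using e unfolding closure_approachable by blast
    moreover obtain j where "from_nat_into D j = x"
      using from_nat_into_surj[OF D(1) \<open>x \<in> D\<close>] by blast
    ultimately show ?thesis
      by blast
  qed
  then show ?thesis
    by (rule that)
qed

text \<open>A set of positive integers has at most as many elements as its maximum, and the maximum
  is itself a level below \<open>x\<close>. Together with the converse estimate this rounds
  \<open>x\<close> to a multiple of \<open>e\<close> by counting the levels it reaches.\<close>

lemma card_levels_le:
  assumes "e > 0" "x \<ge> 0" "L \<subseteq> {1..K}" "\<And>l. l \<in> L \<Longrightarrow> e * real l \<le> x"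
  shows "e * real (card L) \<le> x"
proof (cases "L = {}")
  case False
  have fin: "finite L"
    using assms(3) finite_subset by blast
  have "L \<subseteq> {1..Max L}"
    using assms(3) fin by auto
  then have "card L \<le> Max L"
    using card_mono[of "{1..Max L}" L] by simp
  then have "e * real (card L) \<le> e * real (Max L)"
    using assms(1) by simp
  also have "\<dots> \<le> x"
    using assms(4) Max_in[OF fin False] by blast
  finally show ?thesis .
qed (use assms in simp)

text \<open>All levels up to the integer part of \<open>x / e\<close> lie in \<open>L\<close>, so
  rounding loses at most one step \<open>e\<close>. The bound by \<open>e * real K\<close> ensures
  that the cap \<open>K\<close> cuts off none of them; for negative \<open>x\<close> the claim is
  trivial.\<close>

lemma card_levels_ge:
  assumes "e > 0" "x \<le> e * real K" "\<And>l. l \<in> {1..K} \<Longrightarrow> e * real l \<le> x \<Longrightarrow> l \<in> L" "finite L"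
  shows "x - e \<le> e * real (card L)"
proof (cases "x \<ge> 0")
  case True
  define n where "n = nat \<lfloor>x / e\<rfloor>"
  have n: "real n \<le> x / e" "x / e < real n + 1"
    using True assms(1) by (auto simp: n_def)
  have "x / e \<le> real K"
    using assms(1,2) by (simp add: field_simps)
  then have "n \<le> K"
    using n by linarith
  have "{1..n} \<subseteq> L"
  proof
    fix l
    assume l: "l \<in> {1..n}"
    then have "real l \<le> x / e"
      using n by auto
    then have "e * real l \<le> x"
      using assms(1) by (simp add: field_simps)
    then show "l \<in> L"
      using l \<open>n \<le> K\<close> assms(3) by auto
  qed
  then have "n \<le> card L"
    using card_mono[OF assms(4) \<open>{1..n} \<subseteq> L\<close>] by simp
  then have "x / e \<le> real (card L) + 1"
    using n by linarith
  then show ?thesis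
    using assms(1) by (simp add: field_simps)
next
  case False
  then show ?thesis
    using assms(1) mult_nonneg_nonneg[of e "real (card L)"] by linarith
qed


section \<open>Countable cover by boxes\<close>

text \<open>An index \<open>i\<close> encodes a pair: a point of the dense sequence as centre in the
  second factor, and a radius \<open>1 / (k + 1)\<close> used in both factors.\<close>

lemma lower_semi_equicontinuous_cover:
  fixes A :: "('a::metric_space \<times> 'b::metric_space \<Rightarrow> real) set"
  assumes A: "lower_semi_equicontinuous A"
    and sep: "separable_space (euclidean :: 'b topology)"
    and e: "e > 0"
  obtains R :: "nat \<Rightarrow> 'a set" and B C :: "nat \<Rightarrow> 'b set"
  where "\<And>i. open (R i)" "\<And>i. a \<in> R i" "\<And>i. open (B i)" "\<And>i. C i \<subseteq> B i"
    "\<And>i. C i \<in> sets borel" "(\<Union>i. C i) = UNIV"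
    "\<And>i f y u y'. f \<in> A \<Longrightarrow> y \<in> C i \<Longrightarrow> u \<in> R i \<Longrightarrow> y' \<in> B i \<Longrightarrow> f (a, y) \<le> f (u, y') + e"
proof -
  obtain z :: "nat \<Rightarrow> 'b" where z: "\<And>y e. e > 0 \<Longrightarrow> \<exists>j. dist (z j) y < e"
    using separable_dense_sequence[OF sep] by blast
  define r where "r i = inverse (real (Suc (snd (prod_decode i))))" for i
  define R where "R i = ball a (r i)" for i
  define B where "B i = ball (z (fst (prod_decode i))) (r i)" for i
  \<comment> \<open>The good points of \<open>B i\<close> are those satisfying the estimate for
    every \<open>f\<close> and every point of the box. The intersection may be uncountable, but it
    is one of closed sublevel sets of sections, so \<open>C i\<close> is Borel.\<close>
  define C where "C i = B i \<inter> (\<Inter>f\<in>A. \<Inter>p\<in>R i \<times> B i. {y. f (a, y) \<le> f p + e})" for i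
  have r: "r i > 0" for i
    by (simp add: r_def)
  have lse: "lower_semi_equicontinuous ((\<lambda>f y. f (a, y)) ` A)"
    using A lower_semi_equicontinuous_at_section unfolding lower_semi_equicontinuous_def by blast
  have closed_C: "closed (\<Inter>f\<in>A. \<Inter>p\<in>R i \<times> B i. {y. f (a, y) \<le> f p + e})" for i
    by (intro closed_INT ballI)
      (use lower_semi_equicontinuous_closed_sublevel[OF lse] in blast)
  have "C i \<in> sets borel" for i
    unfolding C_def using closed_C[of i] by (intro sets.Int) (auto simp: B_def)
  moreover have "y \<in> (\<Union>i. C i)" for y
  proof -
    obtain d where d: "d > 0" "\<And>s f. dist s (a, y) < d \<Longrightarrow> f \<in> A \<Longrightarrow> f (a, y) - e \<le> f s"
      using A e unfolding lower_semi_equicontinuous_def lower_semi_equicontinuous_at_iff by meson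
    \<comment> \<open>Three distances, from \<open>u\<close> to \<open>a\<close>, from
      \<open>y'\<close> to the centre and from the centre to \<open>y\<close>, must add up to less
      than \<open>d\<close>.\<close>
    obtain k where k: "inverse (real (Suc k)) < d / 3"
      using reals_Archimedean[of "d / 3"] d(1) by auto
    obtain j where j: "dist (z j) y < inverse (real (Suc k))"
      using z[of "inverse (real (Suc k))" y] by auto
    define i where "i = prod_encode (j, k)"
    have i: "r i = inverse (real (Suc k))" "B i = ball (z j) (r i)"
      by (simp_all add: i_def r_def B_def)
    have "f (a, y) \<le> f (u, y') + e" if "f \<in> A" "u \<in> R i" "y' \<in> B i" for f u y'
    proof -
      have "dist (u, y') (a, y) \<le> dist u a + dist y' y"
        by (simp add: dist_Pair_Pair sqrt_sum_squares_le_sum)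
      also have "\<dots> \<le> dist a u + (dist (z j) y' + dist (z j) y)"
        using dist_triangle3[of y' y "z j"] by (simp add: dist_commute)
      also have "\<dots> < d"
        using that(2,3) j k i by (simp add: R_def)
      finally show ?thesis
        using d(2) that(1) by fastforce
    qed
    moreover have "y \<in> B i"
      using j i by simp
    ultimately have "y \<in> C i"
      by (auto simp: C_def)
    then show ?thesis
      by blast
  qed
  ultimately show ?thesis
    using r by (intro that[of R B C]) (auto simp: R_def B_def C_def)
qed

section \<open>Uniform lower bounds for kernel integrals\<close>

lemma integrable_kernel_section:
  assumes A: "lower_semi_equicontinuous A" "uniformly_bounded_by M A"
    and \<Psi>: "stochastic_kernel \<Psi>" and f: "f \<in> A"
  shows "integrable (\<Psi> s) (\<lambda>y. f (u, y))"
proof -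
  interpret prob_space "\<Psi> s"
    using \<Psi> by (simp add: stochastic_kernel_def)
  have [measurable_cong]: "sets (\<Psi> s) = sets borel"
    using \<Psi> by (simp add: stochastic_kernel_def)
  have [measurable]: "(\<lambda>y. f (u, y)) \<in> borel_measurable borel"
    using lower_semi_equicontinuous_borel_measurable[of "(\<lambda>f y. f (u, y)) ` A"]
      A(1) lower_semi_equicontinuous_at_section f
    unfolding lower_semi_equicontinuous_def by blast
  show ?thesis
    using A(2) f unfolding uniformly_bounded_by_def
    by (intro integrable_const_bound[where B = M]) auto
qed

text \<open>The loss \<open>4 * e\<close> has four equal sources: variation of \<open>f\<close> over
  a box, rounding to levels, the mass outside finitely many \<open>C i\<close>, and the change of
  measure from \<open>\<Psi> c\<close> to \<open>\<Psi> (snd s)\<close>.\<close>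

lemma kernel_integral_lower_bound:
  fixes A :: "('a::metric_space \<times> 'b::metric_space \<Rightarrow> real) set"
    and \<Psi> :: "'c::metric_space \<Rightarrow> 'b measure"
  assumes A: "lower_semi_equicontinuous A" "uniformly_bounded_by M A"
    and \<Psi>: "stochastic_kernel \<Psi>" "weakly_continuous_kernel \<Psi>"
    and sep: "separable_space (euclidean :: 'b topology)"
    and M: "M \<ge> 0" and e: "e > 0"
  shows "\<forall>\<^sub>F s in nhds (a, c). \<forall>f\<in>A.
    (\<integral>y. f (a, y) \<partial>\<Psi> c) - 4 * e \<le> (\<integral>y. f (fst s, y) \<partial>\<Psi> (snd s))"
proof -
  obtain R :: "nat \<Rightarrow> 'a set" and B C :: "nat \<Rightarrow> 'b set"
    where R: "\<And>i. open (R i)" "\<And>i. a \<in> R i"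
      and B: "\<And>i. open (B i)" and C: "\<And>i. C i \<subseteq> B i" "\<And>i. C i \<in> sets borel" "(\<Union>i. C i) = UNIV"
      and RBC: "\<And>i f y u y'. f \<in> A \<Longrightarrow> y \<in> C i \<Longrightarrow> u \<in> R i \<Longrightarrow> y' \<in> B i
        \<Longrightarrow> f (a, y) \<le> f (u, y') + e"
    using lower_semi_equicontinuous_cover[OF A(1) sep e, where a = a] by blast
  have sets_\<Psi> [measurable_cong]: "sets (\<Psi> s) = sets borel" for s
    using \<Psi> by (simp add: stochastic_kernel_def)
  then have space_\<Psi>: "space (\<Psi> s) = UNIV" for s
    using sets_eq_imp_space_eq[of "\<Psi> s" borel] by simp
  have prob: "prob_space (\<Psi> s)" for s
    using \<Psi> by (simp add: stochastic_kernel_def)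
  note integ = integrable_kernel_section[OF A \<Psi>(1)]
  have bound: "f (u, y) \<le> M" "- M \<le> f (u, y)" if "f \<in> A" for f u y
    using A(2) that unfolding uniformly_bounded_by_def by (simp_all add: abs_le_iff minus_le_iff)

  define E where "E n = (\<Union>i<n. C i)" for n
  have E_sets: "E n \<in> sets borel" for n
    using C(2) by (auto simp: E_def)
  \<comment> \<open>Off \<open>E n\<close> the error is at most \<open>2 * M\<close>, so this mass
    costs at most \<open>e\<close>; the added 1 keeps the denominator positive when
    \<open>M = 0\<close>.\<close>
  obtain n where n: "1 - e / (2 * M + 1) < measure (\<Psi> c) (E n)"
  proof -
    interpret prob_space "\<Psi> c" by (rule prob)
    have "(\<lambda>n. measure (\<Psi> c) (E n)) \<longlonglongrightarrow> measure (\<Psi> c) (\<Union>n. E n)"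
    proof (rule finite_Lim_measure_incseq)
      show "incseq E"
        unfolding E_def by (intro incseq_SucI) (auto simp: less_Suc_eq)
    qed (use E_sets sets_\<Psi> in auto)
    moreover have "(\<Union>n. E n) = space (\<Psi> c)"
      using C(3) space_\<Psi> unfolding E_def by blast
    ultimately have "(\<lambda>n. measure (\<Psi> c) (E n)) \<longlonglongrightarrow> 1"
      by (simp add: prob_space)
    then have "\<forall>\<^sub>F n in sequentially. 1 - e / (2 * M + 1) < measure (\<Psi> c) (E n)"
      by (rule order_tendstoD) (use M e in simp)
    then show ?thesis
      using that eventually_happens[of _ sequentially] by auto
  qed

  \<comment> \<open>With \<open>K\<close> levels of height \<open>e\<close> the whole range of
    \<open>f + M\<close>, which lies between 0 and \<open>2 * M\<close>, is covered.\<close>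
  define K where "K = nat \<lceil>2 * M / e\<rceil>"
  have K: "2 * M \<le> e * real K"
  proof -
    have "2 * M / e \<le> real K"
      unfolding K_def by linarith
    then show ?thesis
      using e by (simp add: field_simps)
  qed
  \<comment> \<open>Boxes on which \<open>f + M\<close> stays above level \<open>l\<close>.
    Quantifying over all of \<open>R i\<close> makes the resulting bound independent of
    \<open>u\<close>.\<close>
  define I where "I f l = {i. i < n \<and> (\<forall>u\<in>R i. \<forall>y\<in>B i. e * real l \<le> f (u, y) + M)}" for f l
  define U where "U J = (\<Union>i\<in>J. B i)" for J
  have U_open: "open (U J)" for J
    using B by (auto simp: U_def)
  have U_sets [measurable]: "U J \<in> sets borel" for J
    using U_open by simp
  \<comment> \<open>A discrete layer-cake sum: each level contributes \<open>e\<close> times the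
    indicator of an open set on which \<open>f + M\<close> is known to reach it.\<close>
  define \<phi> where "\<phi> f y = e * (\<Sum>l\<in>{1..K}. indicat_real (U (I f l)) y)" for f y
  have \<phi>_card: "\<phi> f y = e * real (card {l\<in>{1..K}. y \<in> U (I f l)})" for f y
    by (simp add: \<phi>_def indicator_def Int_def flip: sum.inter_filter)
  have integrable_U: "integrable (\<Psi> s) (indicat_real (U J))" for s J
  proof -
    interpret prob_space "\<Psi> s" by (rule prob)
    show ?thesis
      by (intro integrable_real_indicator) (simp_all add: less_top[symmetric])
  qed
  have \<phi>_integrable: "integrable (\<Psi> s) (\<phi> f)" for s f
    unfolding \<phi>_def
    by (intro integrable_mult_right Bochner_Integration.integrable_sum integrable_U)
  have \<phi>_integral: "(\<integral>y. \<phi> f y \<partial>\<Psi> s) = e * (\<Sum>l\<in>{1..K}. measure (\<Psi> s) (U (I f l)))" for s f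
    unfolding \<phi>_def by (simp add: Bochner_Integration.integral_sum integrable_U space_\<Psi>)
  have \<phi>_le: "\<phi> f y \<le> f (u, y) + M" if "f \<in> A" "\<And>i. i < n \<Longrightarrow> u \<in> R i" for f u y
    unfolding \<phi>_card
  proof (rule card_levels_le[OF e])
    show "0 \<le> f (u, y) + M"
      using bound(2)[OF that(1), of u y] by simp
    show "e * real l \<le> f (u, y) + M" if "l \<in> {l \<in> {1..K}. y \<in> U (I f l)}" for l
      using that \<open>\<And>i. i < n \<Longrightarrow> u \<in> R i\<close> by (auto simp: U_def I_def)
  qed auto
  have \<phi>_ge: "f (a, y) + M - 2 * e \<le> \<phi> f y" if f: "f \<in> A" and y: "y \<in> E n" for f y
  proof -
    obtain i where i: "i < n" "y \<in> C i"
      using y by (auto simp: E_def)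
    have "(f (a, y) + M - e) - e \<le> \<phi> f y"
      unfolding \<phi>_card
    proof (rule card_levels_ge[OF e])
      show "f (a, y) + M - e \<le> e * real K"
        using bound(1)[OF f, of a y] K e by linarith
      show "l \<in> {l \<in> {1..K}. y \<in> U (I f l)}" if l: "l \<in> {1..K}" "e * real l \<le> f (a, y) + M - e" for l
      proof -
        \<comment> \<open>As \<open>y\<close> lies in \<open>C i\<close>, passing from
          \<open>f (a, y)\<close> to any value on the box costs at most \<open>e\<close>, which the
          reduced level already allows for.\<close>
        have "i \<in> I f l"
          using i(1) l(2) RBC[OF f i(2)] by (force simp: I_def)
        then show ?thesis
          using l(1) i(2) C(1) by (auto simp: U_def)
      qed
    qed simp
    then show ?thesis
      by simp
  qed
  have \<phi>_nonneg: "0 \<le> \<phi> f y" for f y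
    using e by (simp add: \<phi>_card)

  have \<phi>_integral_ge: "(\<integral>y. f (a, y) \<partial>\<Psi> c) + M - 3 * e \<le> (\<integral>y. \<phi> f y \<partial>\<Psi> c)" if f: "f \<in> A" for f
  proof -
    interpret prob_space "\<Psi> c" by (rule prob)
    have "measure (\<Psi> c) (UNIV - E n) = 1 - measure (\<Psi> c) (E n)"
      using prob_compl[of "E n"] E_sets sets_\<Psi> space_\<Psi> by simp
    then have "measure (\<Psi> c) (UNIV - E n) \<le> e / (2 * M + 1)"
      using n by simp
    then have "2 * M * measure (\<Psi> c) (UNIV - E n) \<le> 2 * M * (e / (2 * M + 1))"
      using M by (intro mult_left_mono) auto
    also have "\<dots> \<le> e"
      using M e by (simp add: field_simps)
    finally have E_compl: "2 * M * measure (\<Psi> c) (UNIV - E n) \<le> e" .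
    have integrable_E: "integrable (\<Psi> c) (indicat_real (UNIV - E n))"
      by (intro integrable_real_indicator) (use E_sets in \<open>auto simp: less_top[symmetric] sets_\<Psi>\<close>)
    \<comment> \<open>On \<open>E n\<close> the step function is within \<open>2 * e\<close>;
      elsewhere it is nonnegative and \<open>f + M\<close> is at most \<open>2 * M\<close>.\<close>
    have "(\<integral>y. f (a, y) + (M - 2 * e) \<partial>\<Psi> c)
        \<le> (\<integral>y. \<phi> f y + 2 * M * indicat_real (UNIV - E n) y \<partial>\<Psi> c)"
    proof (intro integral_mono Bochner_Integration.integrable_add integ[OF f] \<phi>_integrable
        integrable_mult_right integrable_E)
      show "f (a, y) + (M - 2 * e) \<le> \<phi> f y + 2 * M * indicat_real (UNIV - E n) y" for y
        using \<phi>_ge[OF f, of y] \<phi>_nonneg[of f y] bound(1)[OF f, of a y] e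
        by (cases "y \<in> E n") auto
    qed auto
    then have "(\<integral>y. f (a, y) \<partial>\<Psi> c) + (M - 2 * e)
        \<le> (\<integral>y. \<phi> f y \<partial>\<Psi> c) + 2 * M * measure (\<Psi> c) (UNIV - E n)"
      using integ[OF f] \<phi>_integrable integrable_E by (simp add: space_\<Psi> prob_space[unfolded space_\<Psi>])
    with E_compl show ?thesis
      by simp
  qed

  have "\<forall>\<^sub>F u in nhds a. \<forall>i\<in>{..<n}. u \<in> R i"
    using R by (intro eventually_ball_finite ballI eventually_nhds_in_open) auto
  then have ev1: "\<forall>\<^sub>F s in nhds (a, c). \<forall>i\<in>{..<n}. fst s \<in> R i"
    by (rule eventually_compose_filterlim) (use tendsto_fst[OF filterlim_ident, of "(a, c)"] in simp)
  \<comment> \<open>Each of the \<open>K\<close> levels may lose \<open>\<eta>\<close>, for a total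
    of at most \<open>e\<close> after scaling; the added 1 covers \<open>K = 0\<close>.\<close>
  define \<eta> where "\<eta> = 1 / (real K + 1)"
  have "\<forall>\<^sub>F s in nhds c. \<forall>J\<in>Pow {..<n}. measure (\<Psi> c) (U J) - \<eta> < measure (\<Psi> s) (U J)"
    by (intro eventually_ball_finite ballI weakly_continuous_kernel_open \<Psi> U_open) (auto simp: \<eta>_def)
  then have ev2: "\<forall>\<^sub>F s in nhds (a, c).
      \<forall>J\<in>Pow {..<n}. measure (\<Psi> c) (U J) - \<eta> < measure (\<Psi> (snd s)) (U J)"
    by (rule eventually_compose_filterlim) (use tendsto_snd[OF filterlim_ident, of "(a, c)"] in simp)
  from ev1 ev2 show ?thesis
  proof eventually_elim
    case (elim s)
    show ?case
    proof
      fix f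
      assume f: "f \<in> A"
      interpret prob_space "\<Psi> (snd s)" by (rule prob)
      \<comment> \<open>The neighbourhood was chosen for all subsets of \<open>{..<n}\<close> at
        once, before \<open>f\<close> was fixed, so it serves every \<open>f\<close> and every
        level.\<close>
      have "I f l \<in> Pow {..<n}" for l
        by (auto simp: I_def)
      then have "(\<Sum>l\<in>{1..K}. measure (\<Psi> c) (U (I f l)) - \<eta>)
          \<le> (\<Sum>l\<in>{1..K}. measure (\<Psi> (snd s)) (U (I f l)))"
        using elim(2) by (intro sum_mono less_imp_le) blast
      then have "e * ((\<Sum>l\<in>{1..K}. measure (\<Psi> c) (U (I f l))) - real K * \<eta>)
          \<le> (\<integral>y. \<phi> f y \<partial>\<Psi> (snd s))"
        unfolding \<phi>_integral using e by (intro mult_left_mono) (auto simp: sum_subtractf)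
      moreover have "e * (real K * \<eta>) \<le> e * 1"
        using e by (intro mult_left_mono) (auto simp: \<eta>_def)
      ultimately have "(\<integral>y. \<phi> f y \<partial>\<Psi> c) - e \<le> (\<integral>y. \<phi> f y \<partial>\<Psi> (snd s))"
        unfolding \<phi>_integral[of c f] by (simp add: right_diff_distrib)
      also have "\<dots> \<le> (\<integral>y. f (fst s, y) + M \<partial>\<Psi> (snd s))"
        using elim(1) by (intro integral_mono \<phi>_integrable Bochner_Integration.integrable_add integ[OF f] \<phi>_le[OF f]) auto
      also have "\<dots> = (\<integral>y. f (fst s, y) \<partial>\<Psi> (snd s)) + M"
        using integ[OF f] by (simp add: prob_space[unfolded space_\<Psi>] space_\<Psi>)
      finally show "(\<integral>y. f (a, y) \<partial>\<Psi> c) - 4 * e \<le> (\<integral>y. f (fst s, y) \<partial>\<Psi> (snd s))"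
        using \<phi>_integral_ge[OF f] by simp
    qed
  qed
qed

section \<open>Equicontinuity and boundedness of the family of kernel integrals\<close>

theorem theorem1:
  fixes A :: "('s1::metric_space \<times> 's2::metric_space \<Rightarrow> real) set"
    and \<Psi> :: "'s3::metric_space \<Rightarrow> 's2 measure"
    and M :: real
  assumes "\<forall>f\<in>A. lower_semi_continuous f"
    and "lower_semi_equicontinuous A"
    and "uniformly_bounded_by M A"
    and "stochastic_kernel \<Psi>"
    and "weakly_continuous_kernel \<Psi>"
    and "separable_space (euclidean :: 's2 topology)"
  shows "lower_semi_equicontinuous (kernel_integrals \<Psi> A) \<and>
         uniformly_bounded_by M (kernel_integrals \<Psi> A)"
proof (cases "A = {}")
  \<comment> \<open>The empty family is treated apart because it permits a negative
    \<open>M\<close>.\<close>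
  case True
  then show ?thesis
    by (auto simp: kernel_integrals_def lower_semi_equicontinuous_def uniformly_bounded_by_def
        lower_semi_equicontinuous_at_iff intro: exI[of _ 1])
next
  case False
  then obtain f where "f \<in> A"
    by blast
  then have M: "M \<ge> 0"
    using assms(3) abs_ge_zero[of "f undefined"] order_trans unfolding uniformly_bounded_by_def by blast
  have "lower_semi_equicontinuous_at (kernel_integrals \<Psi> A) (a, c)" for a c
    unfolding lower_semi_equicontinuous_at_iff
  proof (intro allI impI)
    fix e :: real
    assume "e > 0"
    then have "\<forall>\<^sub>F s in nhds (a, c). \<forall>f\<in>A.
        (\<integral>y. f (a, y) \<partial>\<Psi> c) - 4 * (e / 4) \<le> (\<integral>y. f (fst s, y) \<partial>\<Psi> (snd s))"
      by (intro kernel_integral_lower_bound[OF assms(2-6) M]) simp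
    then show "\<exists>d>0. \<forall>s. dist s (a, c) < d \<longrightarrow>
        (\<forall>g\<in>kernel_integrals \<Psi> A. g (a, c) - e \<le> g s)"
      unfolding eventually_nhds_metric kernel_integrals_def by (fastforce simp: split_beta)
  qed
  moreover have "\<bar>\<integral>y. f (u, y) \<partial>\<Psi> s\<bar> \<le> M" if "f \<in> A" for f u s
  proof -
    interpret prob_space "\<Psi> s"
      using assms(4) by (simp add: stochastic_kernel_def)
    have "- M \<le> f (u, y)" "f (u, y) \<le> M" for y
      using assms(3) that unfolding uniformly_bounded_by_def by (simp_all add: abs_le_iff minus_le_iff)
    then have "(\<integral>y. f (u, y) \<partial>\<Psi> s) \<le> M" "- M \<le> (\<integral>y. f (u, y) \<partial>\<Psi> s)"
      using integrable_kernel_section[OF assms(2-4) that]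
      by (auto intro!: integral_le_const integral_ge_const)
    then show ?thesis
      by (simp add: abs_le_iff minus_le_iff)
  qed
  ultimately show ?thesis
    by (auto simp: lower_semi_equicontinuous_def uniformly_bounded_by_def kernel_integrals_def)
qed

end
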